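(* Let $r\geq 1$ be an integer. There exist a positive constant $\epsilon_0$ and a positive real number $c_r$ depending on $r$ such that the following holds. If $0<\epsilon\leq \epsilon_0$ and $k$ is an integer with $k\geq 2^r\, r!\,\epsilon^{-1}\left(\log\frac{1}{5\epsilon}\right)^r$, then $$c_r\,\frac{k^r}{\epsilon^{r-1}\left(\log(1/\epsilon)\right)^{\binom{r+1}{2}-1}}\;\leq\; W_{\epsilon}(k,r)\;\leq\; \frac{2k^r}{\epsilon^{r-1}}.$$
   Context: For a positive integer $N$, $[N]=\{1,2,\ldots,N\}$; $\log$ is the natural logarithm. Given $\epsilon>0$ and a positive integer $k$, a set $X=\{x_0,\ldots,x_{k-1}\}\subseteq [N]$ is called an $\epsilon$-approximate arithmetic progression of length $k$, or an $\mathrm{AP}_k(\epsilon)$, if there exist $a\in\mathbb{R}$ and $d>0$ (real) such that $|x_i-(a+id)|<\epsilon d$ for all $i\in\{0,1,\ldots,k-1\}$. For positive integers $k,r$ and $\epsilon>0$, $W_\epsilon(k,r)$ denotes the smallest positive integer $N$ such that every coloring of $[N]$ with $r$ colors contains a monochromatic $\mathrm{AP}_k(\epsilon)$. *)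

theory Defs
  imports Complex_Main
begin

(* The listing x of X is not required to be injective; for eps <= 1/2 it automatically is
   (it is even strictly increasing), so X then has exactly k elements. *)
definition approx_AP :: "nat \<Rightarrow> real \<Rightarrow> nat set \<Rightarrow> bool" where
  "approx_AP k \<epsilon> X \<longleftrightarrow>
     (\<exists>(x :: nat \<Rightarrow> nat) (a :: real) (d :: real).
        X = x ` {..<k} \<and> d > 0 \<and>
        (\<forall>i<k. \<bar>real (x i) - (a + real i * d)\<bar> < \<epsilon> * d))"

definition coloring :: "nat \<Rightarrow> nat \<Rightarrow> (nat \<Rightarrow> nat) \<Rightarrow> bool" where
  "coloring N r f \<longleftrightarrow> f ` {1..N} \<subseteq> {1..r}"

definition has_mono_approx_AP :: "real \<Rightarrow> nat \<Rightarrow> nat \<Rightarrow> (nat \<Rightarrow> nat) \<Rightarrow> bool" where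
  "has_mono_approx_AP \<epsilon> k N f \<longleftrightarrow>
     (\<exists>X \<subseteq> {1..N}. approx_AP k \<epsilon> X \<and> (\<exists>c. \<forall>x\<in>X. f x = c))"

(* For eps > 0 and k, r >= 1 such an N exists by van der Waerden's theorem, every exact
   arithmetic progression with positive integer difference being an approximate one. *)
definition W :: "real \<Rightarrow> nat \<Rightarrow> nat \<Rightarrow> nat" where
  "W \<epsilon> k r = (LEAST N. N > 0 \<and> (\<forall>f. coloring N r f \<longrightarrow> has_mono_approx_AP \<epsilon> k N f))"

end

theory Submission
  imports Defs "HOL-Library.FuncSet" "HOL-Library.Disjoint_Sets"
begin

text \<open>
  An approximate progression with difference \<open>d\<close> consists of one point from each of \<open>k\<close> equally
  spaced open windows of width \<open>2\<epsilon>d\<close>. Both bounds come from what happens when a colour is absent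
  from one such window.

  Upper bound (\<open>mono_approx_sequence_exists\<close>). Spread \<open>k\<close> windows over the whole interval, so that
  \<open>d\<close> is about \<open>N / k\<close>. If a fixed colour meets every window, it contains a progression. Otherwise
  some window, which holds about \<open>2\<epsilon>N / k\<close> consecutive integers, misses that colour, and one recurses
  there with one colour less. Each colour after the first thus costs a factor \<open>k / (2\<epsilon>)\<close>.

  Lower bound (\<open>avoidable_step\<close>). Suppose that \<open>n\<close> integers can be coloured with \<open>q\<close> colours without
  a monochromatic progression of length \<open>k'\<close>. Cut a longer interval into blocks of length \<open>n\<close>. In each
  block one of \<open>q + 1\<close> colours is declared missing, and the block gets a copy of the given
  colouring in the other \<open>q\<close> colours. Which colour is missing in which block is prescribed by a word of
  period \<open>m \<approx> L / \<epsilon>\<close>, where \<open>L\<close> is of order \<open>log(1/\<epsilon>)\<close>. Consider a progression of length \<open>k\<close> in a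
  colour \<open>c\<close>, where \<open>k \<ge> (10 L + 2) k'\<close>.

  \<^item> If it spans fewer than about \<open>10 L\<close> blocks, then \<open>k'\<close> consecutive terms share a block, and they
    form a progression that the inner colouring excludes.

  \<^item> Otherwise a subprogression with constant stride puts \<open>L\<close> terms into pairwise distinct blocks, within
    one period of the word; here the length of the interval, at most \<open>k n / (4\<epsilon>)\<close>, bounds \<open>d\<close> and so
    the spacing of these terms. By interpolation between its first and last term, the block of each
    term is known up to four consecutive candidates, so it suffices that in one of these windows of
    four blocks the colour \<open>c\<close> is missing throughout.

  A word with the last property exists by counting (\<open>word_with_constant_windows_exists\<close>): a random
  word fails for one given position and spacing with probability at most \<open>(1 - 1/(q+1)^4)^L\<close>, which is a
  large power of \<open>\<epsilon>\<close>, whereas there are only \<open>O(m^2)\<close> positions and spacings. It is the period that makes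
  the number of events independent of \<open>k\<close>.

  The step multiplies the length by \<open>k / \<epsilon>\<close> up to a constant and divides the admissible \<open>k\<close> by
  \<open>O(log(1/\<epsilon>))\<close>. Iterated (\<open>avoidable_iterated\<close>, \<open>W_lower_explicit\<close>) it gives a lower bound with
  \<open>r choose 2\<close> logarithms in the denominator, and \<open>r choose 2\<close> is at most \<open>((r + 1) choose 2) - 1\<close>.
\<close>

section \<open>Approximate progressions as sequences\<close>

text \<open>
  The difference is an explicit parameter because the arguments below choose it or distinguish cases
  on its size; the offset only matters through differences of terms.
\<close>

definition approx_sequence :: "real \<Rightarrow> nat \<Rightarrow> real \<Rightarrow> (nat \<Rightarrow> nat) \<Rightarrow> bool" where
  "approx_sequence \<epsilon> k d x \<longleftrightarrow> d > 0 \<and> (\<exists>a. \<forall>i<k. \<bar>real (x i) - (a + real i * d)\<bar> < \<epsilon> * d)"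

lemma has_mono_approx_AP_iff:
  "has_mono_approx_AP \<epsilon> k N f \<longleftrightarrow>
     (\<exists>x d c. approx_sequence \<epsilon> k d x \<and> (\<forall>i<k. x i \<in> {1..N} \<and> f (x i) = c))"
proof
  assume "has_mono_approx_AP \<epsilon> k N f"
  then obtain X c where X: "X \<subseteq> {1..N}" "approx_AP k \<epsilon> X" "\<forall>y\<in>X. f y = c"
    unfolding has_mono_approx_AP_def by blast
  from X(2) obtain x a d where x: "X = x ` {..<k}" and "d > 0"
    "\<forall>i<k. \<bar>real (x i) - (a + real i * d)\<bar> < \<epsilon> * d"
    unfolding approx_AP_def by blast
  then have "approx_sequence \<epsilon> k d x" unfolding approx_sequence_def by blast
  moreover have "x i \<in> {1..N} \<and> f (x i) = c" if "i < k" for i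
    using X that unfolding x by fast
  ultimately show "\<exists>x d c. approx_sequence \<epsilon> k d x \<and> (\<forall>i<k. x i \<in> {1..N} \<and> f (x i) = c)"
    by blast
next
  assume "\<exists>x d c. approx_sequence \<epsilon> k d x \<and> (\<forall>i<k. x i \<in> {1..N} \<and> f (x i) = c)"
  then obtain x d c where *: "approx_sequence \<epsilon> k d x" "\<forall>i<k. x i \<in> {1..N} \<and> f (x i) = c"
    by blast
  have "approx_AP k \<epsilon> (x ` {..<k})"
    using *(1) unfolding approx_AP_def approx_sequence_def by blast
  moreover have "x ` {..<k} \<subseteq> {1..N}" "\<forall>y\<in>x ` {..<k}. f y = c"
    using *(2) by auto
  ultimately show "has_mono_approx_AP \<epsilon> k N f"
    unfolding has_mono_approx_AP_def by blast
qed

lemma approx_sequence_diff: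
  assumes "approx_sequence \<epsilon> k d x" "i < k" "j < k"
  shows "\<bar>(real (x j) - real (x i)) - (real j - real i) * d\<bar> < 2 * \<epsilon> * d"
proof -
  from assms obtain a where
    "\<bar>real (x i) - (a + real i * d)\<bar> < \<epsilon> * d" "\<bar>real (x j) - (a + real j * d)\<bar> < \<epsilon> * d"
    unfolding approx_sequence_def by blast
  moreover have "(real j - real i) * d = real j * d - real i * d"
    by (simp add: algebra_simps)
  ultimately show ?thesis by linarith
qed

lemma approx_sequence_strict_mono:
  assumes "approx_sequence \<epsilon> k d x" "\<epsilon> \<le> 1/2" "i < j" "j < k"
  shows "x i < x j"
proof -
  have d: "d > 0" using assms(1) unfolding approx_sequence_def by blast
  have "1 * d \<le> (real j - real i) * d" using d assms(3) by (intro mult_right_mono) auto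
  moreover have "\<epsilon> * d \<le> 1/2 * d" using assms(2) d by (intro mult_right_mono) auto
  moreover have "\<bar>(real (x j) - real (x i)) - (real j - real i) * d\<bar> < 2 * \<epsilon> * d"
    using approx_sequence_diff[OF assms(1)] assms by auto
  ultimately show ?thesis by linarith
qed

text \<open>
  This is how the terms inside one block, after a translation, are moved to the interval of the inner colouring.
\<close>

lemma approx_sequence_shift:
  assumes "approx_sequence \<epsilon> k d x" "t + k' \<le> k" "\<And>i. i < k' \<Longrightarrow> x (t + i) = y i + z"
  shows "approx_sequence \<epsilon> k' d y"
proof -
  from assms(1) obtain a where d: "d > 0" and
    a: "\<forall>i<k. \<bar>real (x i) - (a + real i * d)\<bar> < \<epsilon> * d"
    unfolding approx_sequence_def by blast
  have "\<bar>real (y i) - ((a + real t * d - real z) + real i * d)\<bar> < \<epsilon> * d" if "i < k'" for i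
  proof -
    have "\<bar>real (x (t+i)) - (a + real (t+i) * d)\<bar> < \<epsilon> * d"
      using a[rule_format, of "t + i"] that assms(2) by linarith
    then show ?thesis using assms(3)[OF that] by (simp add: algebra_simps)
  qed
  with d show ?thesis unfolding approx_sequence_def by blast
qed

section \<open>The upper bound\<close>

text \<open>
  Induction on the number of colours, as explained above. The interval may start anywhere and the
  colours may be any set, since the recursion continues in a window and with one colour deleted. The
  strict hypothesis on \<open>N + 1\<close> is the form that survives rounding down: an open interval of length
  greater than \<open>n\<close> contains \<open>n\<close> consecutive integers.
\<close>

lemma mono_approx_sequence_exists:
  fixes \<epsilon> :: real and k r :: nat and C :: "nat set"
  assumes "k \<ge> 1" "0 < \<epsilon>" "\<epsilon> \<le> 1/2"
  assumes "card C = Suc r" "real N + 1 > real k ^ Suc r / (2 * \<epsilon>) ^ r"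
    and "f ` {M + 1..M + N} \<subseteq> C"
  shows "\<exists>x d c. approx_sequence \<epsilon> k d x \<and> (\<forall>i<k. x i \<in> {M + 1..M + N} \<and> f (x i) = c)"
  using assms(4-)
proof (induction r arbitrary: C M N)
  case 0
  then obtain c where "C = {c}" by (auto simp: card_1_singleton_iff)
  then have c: "f y = c" if "y \<in> {M + 1..M + N}" for y
    using "0.prems"(3) that by blast
  have "k \<le> N" using 0 by simp
  then have "\<forall>i<k. M + 1 + i \<in> {M + 1..M + N} \<and> f (M + 1 + i) = c"
    using c by simp
  moreover have "approx_sequence \<epsilon> k 1 (\<lambda>i. M + 1 + i)"
    unfolding approx_sequence_def using assms(2)
    by (auto intro!: exI[of _ "real M + 1"])
  ultimately show ?case by blast
next
  case (Suc r)
  define B where "B = real k ^ Suc r / (2 * \<epsilon>) ^ r"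
  define n where "n = nat \<lfloor>B\<rfloor>"
  have "B \<ge> 0" unfolding B_def using assms by simp
  then have n: "real n \<le> B" "B < real n + 1" unfolding n_def by linarith+
  \<comment> \<open>The span of \<open>k\<close> windows in units of \<open>d\<close>; with this \<open>d\<close> they reach exactly from \<open>M\<close> to
    \<open>M + N + 1\<close>.\<close>
  define h where "h = real k - 1 + 2 * \<epsilon>"
  define d where "d = (real N + 1) / h"
  have h: "h > 0" "h \<le> real k" unfolding h_def using assms by auto
  have d: "d > 0" unfolding d_def using h by simp
  have hd: "h * d = real N + 1" unfolding d_def using h by simp
  have wide: "real n < 2 * \<epsilon> * d"
  proof -
    have "h * real n \<le> real k * B" using h n \<open>B \<ge> 0\<close> by (intro mult_mono) auto
    also have "real k * B / (2 * \<epsilon>) < real N + 1"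
      using Suc.prems(2) unfolding B_def by (simp add: mult_ac)
    then have "real k * B < 2 * \<epsilon> * (h * d)"
      unfolding hd using assms(2) by (simp add: field_simps)
    finally have "h * real n < h * (2 * \<epsilon> * d)" by (simp add: algebra_simps)
    then show ?thesis using h by simp
  qed
  \<comment> \<open>The window with index \<open>i\<close> is the open interval of length \<open>2\<epsilon>d\<close> starting at \<open>M + i d\<close>, hence it
    contains the \<open>n\<close> integers following \<open>M + p i\<close>.\<close>
  define p where "p i = nat \<lfloor>real i * d\<rfloor>" for i :: nat
  have p: "real (p i) \<le> real i * d" "real i * d < real (p i) + 1" for i
  proof -
    have "0 \<le> real i * d" using d by simp
    then show "real (p i) \<le> real i * d" "real i * d < real (p i) + 1"
      unfolding p_def by linarith+
  qed
  have pN: "p i + n \<le> N" if "i < k" for i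
  proof -
    have "real i * d \<le> (real k - 1) * d" using that d by (intro mult_right_mono) auto
    moreover have "h * d = (real k - 1) * d + 2 * \<epsilon> * d" unfolding h_def by (simp add: algebra_simps)
    ultimately have "real (p i) + real n < real N + 1"
      using p[of i] wide hd by linarith
    then show ?thesis by linarith
  qed
  obtain c where c: "c \<in> C" using Suc.prems(1) by fastforce
  show ?case
  proof (cases "\<forall>i<k. \<exists>y \<in> {M + p i + 1..M + p i + n}. f y = c")
    case True
    then obtain x where x: "\<And>i. i < k \<Longrightarrow> x i \<in> {M + p i + 1..M + p i + n} \<and> f (x i) = c"
      by metis
    from x have x_in: "M + p i + 1 \<le> x i" "x i \<le> M + p i + n" "f (x i) = c" if "i < k" for i
      using that by auto
    have "\<bar>real (x i) - ((real M + \<epsilon> * d) + real i * d)\<bar> < \<epsilon> * d" if "i < k" for i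
    proof -
      have "real M + real (p i) + 1 \<le> real (x i)" "real (x i) \<le> real M + real (p i) + real n"
        using x_in(1,2)[OF that] by linarith+
      then show ?thesis using p[of i] wide by linarith
    qed
    then have "approx_sequence \<epsilon> k d x" unfolding approx_sequence_def using d by blast
    moreover have "\<forall>i<k. x i \<in> {M + 1..M + N} \<and> f (x i) = c"
    proof (intro allI impI)
      fix i assume "i < k"
      then show "x i \<in> {M + 1..M + N} \<and> f (x i) = c" using x_in[of i] pN[of i] by simp
    qed
    ultimately show ?thesis by blast
  next
    case False
    then obtain i where i: "i < k" "\<forall>y \<in> {M + p i + 1..M + p i + n}. f y \<noteq> c" by blast
    have sub: "{M + p i + 1..M + p i + n} \<subseteq> {M + 1..M + N}" using pN[OF i(1)] by auto
    have "card (C - {c}) = Suc r" using c Suc.prems(1) by simp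
    moreover have "f ` {M + p i + 1..M + p i + n} \<subseteq> C - {c}"
      using i(2) sub Suc.prems(3) by blast
    ultimately have "\<exists>x d c. approx_sequence \<epsilon> k d x \<and>
        (\<forall>j<k. x j \<in> {M + p i + 1..M + p i + n} \<and> f (x j) = c)"
      using n(2) unfolding B_def by (intro Suc.IH) auto
    then show ?thesis using sub by blast
  qed
qed

lemma W_upper:
  fixes \<epsilon> :: real
  assumes "k \<ge> 1" "0 < \<epsilon>" "\<epsilon> \<le> 1/2"
  shows "real (W \<epsilon> k (Suc r)) \<le> real k ^ Suc r / (2 * \<epsilon>) ^ r"
    and "coloring (W \<epsilon> k (Suc r)) (Suc r) f \<Longrightarrow> has_mono_approx_AP \<epsilon> k (W \<epsilon> k (Suc r)) f"
proof -
  define P where "P N \<longleftrightarrow> N > 0 \<and> (\<forall>f. coloring N (Suc r) f \<longrightarrow> has_mono_approx_AP \<epsilon> k N f)" for N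
  define B where "B = real k ^ Suc r / (2 * \<epsilon>) ^ r"
  define N where "N = nat \<lfloor>B\<rfloor>"
  have "(2 * \<epsilon>) ^ r \<le> 1" using assms by (intro power_le_one) auto
  moreover have "1 \<le> real k ^ Suc r" using assms by (intro one_le_power) auto
  ultimately have "1 \<le> B" unfolding B_def using assms by (simp add: field_simps)
  then have N: "real N \<le> B" "B < real N + 1" "N > 0" unfolding N_def by linarith+
  have "P N" unfolding P_def has_mono_approx_AP_iff coloring_def
  proof (intro conjI allI impI)
    fix f assume "f ` {1..N} \<subseteq> {1..Suc r}"
    then show "\<exists>x d c. approx_sequence \<epsilon> k d x \<and> (\<forall>i<k. x i \<in> {1..N} \<and> f (x i) = c)"
      using mono_approx_sequence_exists[OF assms, of "{1..Suc r}" r N f 0] N(2)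
      unfolding B_def by simp
  qed (rule N(3))
  moreover have W: "W \<epsilon> k (Suc r) = (LEAST N. P N)" unfolding W_def P_def ..
  ultimately have "W \<epsilon> k (Suc r) \<le> N" "P (W \<epsilon> k (Suc r))"
    by (auto intro: Least_le LeastI)
  then show "real (W \<epsilon> k (Suc r)) \<le> real k ^ Suc r / (2 * \<epsilon>) ^ r"
    and "coloring (W \<epsilon> k (Suc r)) (Suc r) f \<Longrightarrow> has_mono_approx_AP \<epsilon> k (W \<epsilon> k (Suc r)) f"
    using N(1) unfolding B_def P_def by auto
qed

section \<open>Avoiding colourings\<close>

definition avoidable :: "real \<Rightarrow> nat \<Rightarrow> nat \<Rightarrow> nat \<Rightarrow> bool" where
  "avoidable \<epsilon> k q N \<longleftrightarrow> (\<exists>f. coloring N q f \<and> \<not> has_mono_approx_AP \<epsilon> k N f)"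

lemma avoidable_less_W:
  assumes "k \<ge> 1" "0 < \<epsilon>" "\<epsilon> \<le> 1/2" "avoidable \<epsilon> k (Suc r) N"
  shows "N < W \<epsilon> k (Suc r)"
proof (rule ccontr)
  assume "\<not> N < W \<epsilon> k (Suc r)"
  then have sub: "{1..W \<epsilon> k (Suc r)} \<subseteq> {1..N}" by auto
  from assms(4) obtain f where f: "coloring N (Suc r) f" "\<not> has_mono_approx_AP \<epsilon> k N f"
    unfolding avoidable_def by blast
  have "coloring (W \<epsilon> k (Suc r)) (Suc r) f" using f(1) sub unfolding coloring_def by blast
  from W_upper(2)[OF assms(1-3) this] have "has_mono_approx_AP \<epsilon> k N f"
    using sub unfolding has_mono_approx_AP_def by blast
  with f(2) show False by blast
qed

lemma avoidable_mono:
  assumes "avoidable \<epsilon> k' q N" "k' \<le> k"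
  shows "avoidable \<epsilon> k q N"
proof -
  have "has_mono_approx_AP \<epsilon> k' N f" if h: "has_mono_approx_AP \<epsilon> k N f" for f
  proof -
    obtain x d c where "approx_sequence \<epsilon> k d x" "\<forall>i<k. x i \<in> {1..N} \<and> f (x i) = c"
      using h unfolding has_mono_approx_AP_iff by blast
    moreover from this assms(2) have "approx_sequence \<epsilon> k' d x"
      unfolding approx_sequence_def by (meson less_le_trans)
    ultimately show ?thesis
      unfolding has_mono_approx_AP_iff using assms(2) by (meson less_le_trans)
  qed
  with assms(1) show ?thesis unfolding avoidable_def by blast
qed

lemma avoidable_one_color:
  assumes "\<epsilon> \<le> 1/2" "N < k"
  shows "avoidable \<epsilon> k 1 N"
proof -
  have "\<not> has_mono_approx_AP \<epsilon> k N (\<lambda>_. 1)"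
  proof
    assume "has_mono_approx_AP \<epsilon> k N (\<lambda>_. 1)"
    then obtain x d where x: "approx_sequence \<epsilon> k d x" "\<forall>i<k. x i \<in> {1..N}"
      unfolding has_mono_approx_AP_iff by blast
    have "inj_on x {..<k}"
      using approx_sequence_strict_mono[OF x(1) assms(1)]
      by (intro linorder_inj_onI) (auto simp: less_imp_neq)
    then have "card {..<k} \<le> card {1..N}" using x(2) by (intro card_inj_on_le[of x]) auto
    with assms(2) show False by simp
  qed
  then show ?thesis unfolding avoidable_def coloring_def by (intro exI[of _ "\<lambda>_. 1"]) auto
qed


section \<open>Words with constant windows\<close>

text \<open>
  For independent uniform letters, each of the \<open>L\<close> disjoint sets of size \<open>h\<close> fails to be constantly
  \<open>c\<close> with probability \<open>1 - 1 / |A|^h\<close>. The induction splits a word into its restrictions to the last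
  set and to the rest.
\<close>

lemma card_words_avoiding_patterns:
  fixes A :: "'a set" and S :: "nat \<Rightarrow> 'b set"
  assumes "finite A" "c \<in> A"
    and "finite I" "\<And>s. s < L \<Longrightarrow> S s \<subseteq> I \<and> card (S s) = h" "disjoint_family_on S {..<L}"
  shows "real (card {w \<in> I \<rightarrow>\<^sub>E A. \<forall>s<L. \<exists>b\<in>S s. w b \<noteq> c})
          \<le> (1 - 1 / real (card A) ^ h) ^ L * real (card A) ^ card I"
  using assms(3-)
proof (induction L arbitrary: I)
  case 0
  then show ?case by (simp add: card_PiE)
next
  case (Suc L)
  define q where "q = card A"
  have q: "q > 0" unfolding q_def using assms(1,2) by (auto simp: card_gt_0_iff)
  define T where "T = S L"
  define J where "J = I - T"
  define U where "U = {w \<in> J \<rightarrow>\<^sub>E A. \<forall>s<L. \<exists>b\<in>S s. w b \<noteq> c}"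
  define V where "V = (T \<rightarrow>\<^sub>E A) - {restrict (\<lambda>_. c) T}"
  have T: "T \<subseteq> I" "card T = h" "finite T"
    using Suc.prems(1,2) unfolding T_def by (auto intro: finite_subset)
  have J: "finite J" "card I = card J + h"
    unfolding J_def using T Suc.prems(1) card_mono[of I T] by (auto simp: card_Diff_subset)
  have SJ: "S s \<subseteq> J" if "s < L" for s
  proof -
    have "S s \<inter> T = {}"
      using disjoint_family_onD[OF Suc.prems(3), of s L] that unfolding T_def by simp
    then show ?thesis using Suc.prems(2)[of s] that unfolding J_def by auto
  qed
  have U: "real (card U) \<le> (1 - 1 / real q ^ h) ^ L * real q ^ card J"
    unfolding U_def q_def using Suc.prems J SJ
    by (intro Suc.IH) (auto simp: disjoint_family_on_def)
  have finU: "finite U" unfolding U_def using J assms(1) by (intro finite_subset[OF _ finite_PiE]) auto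
  have finV: "finite V" unfolding V_def using T assms(1) by (auto intro: finite_PiE)
  have "restrict (\<lambda>_. c) T \<in> T \<rightarrow>\<^sub>E A" using assms(2) by auto
  then have "card V = q ^ h - 1"
    unfolding V_def q_def using T by (subst card_Diff_singleton) (auto simp: card_PiE)
  then have V: "real (card V) = (1 - 1 / real q ^ h) * real q ^ h"
    using q by (simp add: of_nat_diff Suc_le_eq field_simps)
  define split where "split w = (restrict w J, restrict w T)" for w :: "'b \<Rightarrow> 'a"
  let ?W = "{w \<in> I \<rightarrow>\<^sub>E A. \<forall>s<Suc L. \<exists>b\<in>S s. w b \<noteq> c}"
  have "inj_on split ?W"
  proof (rule inj_onI)
    fix v w assume *: "v \<in> ?W" "w \<in> ?W" "split v = split w"
    then have "v b = w b" if "b \<in> I" for b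
      using that unfolding split_def J_def
      by (cases "b \<in> T") (auto dest: fun_cong[of _ _ b])
    then show "v = w" using *(1,2) by (auto intro: PiE_ext)
  qed
  moreover have "split ` ?W \<subseteq> U \<times> V"
  proof
    fix p assume "p \<in> split ` ?W"
    then obtain w where "w \<in> ?W" and p: "p = (restrict w J, restrict w T)"
      unfolding split_def by blast
    then have w: "w \<in> I \<rightarrow>\<^sub>E A" "\<And>s. s < Suc L \<Longrightarrow> \<exists>b\<in>S s. w b \<noteq> c" by auto
    have "\<exists>b\<in>S s. restrict w J b \<noteq> c" if "s < L" for s
    proof -
      obtain b where "b \<in> S s" "w b \<noteq> c" using w(2)[of s] \<open>s < L\<close> by auto
      then show ?thesis using SJ[OF that] by (intro bexI[of _ b]) auto
    qed
    moreover have "restrict w J \<in> J \<rightarrow>\<^sub>E A"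
      using w(1) unfolding J_def by auto
    ultimately have "restrict w J \<in> U" unfolding U_def by blast
    moreover obtain b where b: "b \<in> T" "w b \<noteq> c" using w(2)[of L] unfolding T_def by auto
    then have "restrict w T \<noteq> restrict (\<lambda>_. c) T" by (metis restrict_apply')
    then have "restrict w T \<in> V"
      using w(1) T(1) unfolding V_def by auto
    ultimately show "p \<in> U \<times> V" unfolding p by blast
  qed
  ultimately have "card ?W \<le> card (U \<times> V)"
    using finU finV by (intro card_inj_on_le) auto
  then have "real (card ?W) \<le> real (card U) * real (card V)"
    unfolding card_cartesian_product of_nat_mult[symmetric] of_nat_le_iff .
  also have "\<dots> \<le> ((1 - 1 / real q ^ h) ^ L * real q ^ card J) * ((1 - 1 / real q ^ h) * real q ^ h)"
    using U V by (intro mult_mono) auto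
  also have "\<dots> = (1 - 1 / real q ^ h) ^ Suc L * real q ^ card I"
    by (simp add: J(2) power_add mult_ac)
  finally show ?case unfolding q_def .
qed


lemma inj_on_mod_short_interval:
  fixes a m :: nat
  shows "inj_on (\<lambda>x. x mod m) {a..<a + m}"
proof (rule linorder_inj_onI)
  fix x y :: nat
  assume xy: "x < y" "x \<in> {a..<a + m}" "y \<in> {a..<a + m}"
  show "x mod m \<noteq> y mod m"
  proof
    assume "x mod m = y mod m"
    then have "m dvd y - x" using xy(1) by (metis mod_eq_dvd_iff_nat less_imp_le)
    then have "m \<le> y - x" using xy(1) by (intro dvd_imp_le) auto
    with xy show False by auto
  qed
qed auto

text \<open>
  The union bound over all colours \<open>c\<close>, starting positions \<open>\<alpha>\<close> modulo \<open>m\<close>, and spans \<open>u\<close>. The windows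
  start at the integer parts of \<open>\<alpha> + s u / L\<close>. Since \<open>u \<ge> 4 L\<close> they are disjoint before reduction modulo
  \<open>m\<close>, and since \<open>u \<le> m\<close> they lie in one period and remain disjoint after it.
\<close>

lemma word_with_constant_windows_exists:
  fixes q m L :: nat
  assumes "q \<ge> 1" "m \<ge> 1"
    and small: "real q * real m * real (m + 1) * (1 - 1 / real q ^ 4) ^ L < 1"
  obtains w where "\<And>i. i < m \<Longrightarrow> w i \<in> {1..q}"
    and "\<And>c \<alpha> u. \<lbrakk>c \<in> {1..q}; 4 * L \<le> u; u \<le> m\<rbrakk>
            \<Longrightarrow> \<exists>s<L. \<forall>e<4. w ((\<alpha> + s * u div L + e) mod m) = c"
proof -
  define A where "A = {1..q}"
  define S where "S \<alpha> u s = (\<lambda>e. (\<alpha> + s * u div L + e) mod m) ` {..<4}" for \<alpha> u s :: nat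
  define words where "words = {..<m} \<rightarrow>\<^sub>E A"
  define bad where "bad c \<alpha> u = {w \<in> words. \<forall>s<L. \<exists>b\<in>S \<alpha> u s. w b \<noteq> c}" for c \<alpha> u
  define T where "T = {1..q} \<times> {..<m} \<times> {4 * L..m}"
  define \<beta> where "\<beta> = (1 - 1 / real q ^ 4) ^ L * real q ^ m"
  have \<beta>: "\<beta> \<ge> 0" unfolding \<beta>_def using assms(1) by (intro mult_nonneg_nonneg zero_le_power) auto
  have bad: "real (card (bad c \<alpha> u)) \<le> \<beta>" if "(c, \<alpha>, u) \<in> T" for c \<alpha> u
  proof -
    have u: "4 * L \<le> u" "u \<le> m" and c: "c \<in> {1..q}" using that unfolding T_def by auto
    define lo where "lo s = \<alpha> + s * u div L" for s
    have lo_Suc: "lo s + 4 \<le> lo (Suc s)" if "L > 0" for s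
    proof -
      have "s * u div L + 4 = (s * u + 4 * L) div L" using that by simp
      also have "\<dots> \<le> (Suc s * u) div L" using u(1) by (intro div_le_mono) simp
      finally show ?thesis unfolding lo_def by simp
    qed
    have lo_less: "lo s + 4 \<le> lo t" if "s < t" "L > 0" for s t
      using that(1)
    proof (induction t)
      case (Suc t)
      then show ?case using lo_Suc[OF that(2), of t] by (cases "s = t") auto
    qed simp
    have window: "{lo s..<lo s + 4} \<subseteq> {\<alpha>..<\<alpha> + m}" if "s < L" for s
    proof -
      have "lo s + 4 \<le> lo L" using lo_less that by auto
      also have "lo L = \<alpha> + u" unfolding lo_def using that by simp
      finally show ?thesis using u(2) unfolding lo_def by auto
    qed
    have S: "S \<alpha> u s = (\<lambda>x. x mod m) ` {lo s..<lo s + 4}" for s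
    proof -
      have "{lo s..<lo s + 4} = (+) (lo s) ` {..<4}"
        by (simp add: lessThan_atLeast0 add.commute)
      then show ?thesis unfolding S_def lo_def by (simp add: image_image)
    qed
    note inj = inj_on_mod_short_interval[where a = \<alpha> and m = m]
    have "S \<alpha> u s \<subseteq> {..<m} \<and> card (S \<alpha> u s) = 4" if "s < L" for s
      unfolding S using assms(2) inj_on_subset[OF inj window[OF that]]
      by (auto simp: card_image)
    moreover have "disjoint_family_on (S \<alpha> u) {..<L}"
    proof -
      have "S \<alpha> u s \<inter> S \<alpha> u t = {}" if "s < t" "t < L" for s t
      proof -
        have "{lo s..<lo s + 4} \<inter> {lo t..<lo t + 4} = {}" using lo_less[of s t] that by auto
        moreover have "{lo s..<lo s + 4} \<subseteq> {\<alpha>..<\<alpha> + m}" "{lo t..<lo t + 4} \<subseteq> {\<alpha>..<\<alpha> + m}"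
          using window[of s] window[of t] that by auto
        ultimately show ?thesis
          unfolding S using inj_on_image_Int[OF inj] by (metis image_empty)
      qed
      then show ?thesis
        unfolding disjoint_family_on_def by (metis Int_commute lessThan_iff linorder_neqE_nat)
    qed
    ultimately show ?thesis
      using card_words_avoiding_patterns[of A c "{..<m}" L "S \<alpha> u" 4] c
      unfolding bad_def words_def \<beta>_def A_def by simp
  qed
  have "real (card (\<Union>(c, \<alpha>, u)\<in>T. bad c \<alpha> u)) \<le> (\<Sum>(c, \<alpha>, u)\<in>T. real (card (bad c \<alpha> u)))"
  proof -
    have "card (\<Union>p\<in>T. case p of (c, \<alpha>, u) \<Rightarrow> bad c \<alpha> u) \<le> (\<Sum>p\<in>T. card (case p of (c, \<alpha>, u) \<Rightarrow> bad c \<alpha> u))"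
      by (rule card_UN_le) (simp add: T_def)
    also have "\<dots> = (\<Sum>(c, \<alpha>, u)\<in>T. card (bad c \<alpha> u))" by (intro sum.cong) auto
    finally have "real (card (\<Union>(c, \<alpha>, u)\<in>T. bad c \<alpha> u)) \<le> real (\<Sum>(c, \<alpha>, u)\<in>T. card (bad c \<alpha> u))"
      by (rule of_nat_mono)
    then show ?thesis by (simp add: case_prod_unfold)
  qed
  also have "\<dots> \<le> (\<Sum>(c, \<alpha>, u)\<in>T. \<beta>)" using bad by (intro sum_mono) auto
  also have "\<dots> = real (card T) * \<beta>" by (simp add: case_prod_unfold)
  also have "\<dots> \<le> (real q * real m * real (m + 1)) * \<beta>"
  proof (intro mult_right_mono \<beta>)
    have "card T \<le> card ({1..q} \<times> {..<m} \<times> {..m})"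
      unfolding T_def by (intro card_mono) auto
    also have "\<dots> = q * m * (m + 1)" by (simp add: card_cartesian_product algebra_simps)
    finally have "card T \<le> q * m * (m + 1)" .
    then have "real (card T) \<le> real (q * m * (m + 1))" by (rule of_nat_mono)
    then show "real (card T) \<le> real q * real m * real (m + 1)" by (simp only: of_nat_mult)
  qed
  also have "\<dots> = (real q * real m * real (m + 1) * (1 - 1 / real q ^ 4) ^ L) * real q ^ m"
    unfolding \<beta>_def by (simp add: mult_ac)
  also have "\<dots> < 1 * real q ^ m" using small assms(1) by (intro mult_strict_right_mono) auto
  also have "\<dots> = real (card words)" unfolding words_def A_def by (simp add: card_PiE)
  finally have "card (\<Union>(c, \<alpha>, u)\<in>T. bad c \<alpha> u) < card words" by (simp only: of_nat_less_iff)
  moreover have "finite (\<Union>(c, \<alpha>, u)\<in>T. bad c \<alpha> u)"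
  proof (rule finite_subset)
    show "finite words" unfolding words_def A_def by (intro finite_PiE) auto
  qed (auto simp: bad_def)
  ultimately obtain w where w: "w \<in> words" "w \<notin> (\<Union>(c, \<alpha>, u)\<in>T. bad c \<alpha> u)"
    by (metis card_mono not_less subsetI)
  show ?thesis
  proof
    show "w i \<in> {1..q}" if "i < m" for i using PiE_mem[OF w(1)[unfolded words_def]] that unfolding A_def by simp
    fix c \<alpha> u assume c: "c \<in> {1..q}" and u: "4 * L \<le> u" "u \<le> m"
    have "(c, \<alpha> mod m, u) \<in> T" unfolding T_def using c u assms(2) by auto
    then have "w \<notin> bad c (\<alpha> mod m) u" using w(2) by blast
    then obtain s where "s < L" "\<forall>b\<in>S (\<alpha> mod m) u s. w b = c"
      using w(1) unfolding bad_def by blast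
    moreover have "(\<alpha> mod m + s * u div L + e) mod m = (\<alpha> + s * u div L + e) mod m" for e
      using mod_add_left_eq[of \<alpha> m "s * u div L + e"] by (simp only: add.assoc)
    ultimately have "\<forall>e<4. w ((\<alpha> + s * u div L + e) mod m) = c"
      unfolding S_def by (simp only: ball_simps lessThan_iff) simp
    with \<open>s < L\<close> show "\<exists>s<L. \<forall>e<4. w ((\<alpha> + s * u div L + e) mod m) = c" by blast
  qed
qed


section \<open>Adding a colour\<close>

text \<open>
  The exact progression is affine, and each of the three terms deviates from it by less than \<open>\<epsilon>d\<close>.
  Thus the blocks of all intermediate terms are determined, up to a bounded error, by the blocks of
  the two end terms, which leaves few configurations for the union bound.
\<close>

lemma approx_sequence_interpolate:
  assumes x: "approx_sequence \<epsilon> k d x" and "s \<le> L" "L > 0" "j * L < k"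
  shows "\<bar>real L * real (x (j * s)) - ((real L - real s) * real (x 0) + real s * real (x (j * L)))\<bar>
           < real L * (2 * \<epsilon> * d)"
proof -
  obtain a where a: "\<And>i. i < k \<Longrightarrow> \<bar>real (x i) - (a + real i * d)\<bar> < \<epsilon> * d"
    using x unfolding approx_sequence_def by blast
  define \<delta> where "\<delta> i = real (x i) - (a + real i * d)" for i
  have "j * s \<le> j * L" using assms(2) by simp
  then have \<delta>: "\<bar>\<delta> 0\<bar> < \<epsilon> * d" "\<bar>\<delta> (j * s)\<bar> < \<epsilon> * d" "\<bar>\<delta> (j * L)\<bar> < \<epsilon> * d"
    unfolding \<delta>_def using assms(4) by (auto simp only: intro!: a)
  have "real L * real (x (j * s)) - ((real L - real s) * real (x 0) + real s * real (x (j * L)))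
      = real L * \<delta> (j * s) - (real L - real s) * \<delta> 0 - real s * \<delta> (j * L)"
    unfolding \<delta>_def by (simp add: algebra_simps)
  moreover have "\<bar>real L * \<delta> (j * s)\<bar> < real L * (\<epsilon> * d)"
    using \<delta>(2) assms(3) by (simp add: abs_mult)
  moreover have "\<bar>(real L - real s) * \<delta> 0\<bar> \<le> (real L - real s) * (\<epsilon> * d)"
    unfolding abs_mult using \<delta>(1) assms(2) by (intro mult_mono) auto
  moreover have "\<bar>real s * \<delta> (j * L)\<bar> \<le> real s * (\<epsilon> * d)"
    unfolding abs_mult using \<delta>(3) by (intro mult_mono) auto
  moreover have "(real L - real s) * (\<epsilon> * d) = real L * (\<epsilon> * d) - real s * (\<epsilon> * d)"
    by (simp add: algebra_simps)
  moreover have "real L * (2 * \<epsilon> * d) = 2 * (real L * (\<epsilon> * d))" by simp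
  ultimately show ?thesis by linarith
qed

text \<open>
  Otherwise each of the \<open>T\<close> consecutive stretches would contribute an increase of at least one. It
  is applied to the sequence of blocks that the terms of a progression visit.
\<close>

lemma constant_stretch_exists:
  fixes B :: "nat \<Rightarrow> nat"
  assumes mono: "\<And>i j. i \<le> j \<Longrightarrow> j < T * n \<Longrightarrow> B i \<le> B j"
    and "n \<ge> 1" "T \<ge> 1" and few: "B (T * n - 1) < B 0 + T"
  shows "\<exists>t<T. \<forall>i<n. B (t * n + i) = B (t * n)"
proof (rule ccontr)
  assume none: "\<not> ?thesis"
  have le: "t * n + n \<le> T * n" if "t < T" for t
    using mult_le_mono1[of "Suc t" T n] that by simp
  have jump: "B (t * n) < B (t * n + n - 1)" if t: "t < T" for t
  proof -
    obtain i where i: "i < n" "B (t * n + i) \<noteq> B (t * n)" using none t by blast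
    have "B (t * n) \<le> B (t * n + i)" "B (t * n + i) \<le> B (t * n + n - 1)"
      using i(1) le[OF t] by (auto intro!: mono)
    with i(2) show ?thesis by linarith
  qed
  have "t < T \<Longrightarrow> B 0 + Suc t \<le> B (t * n + n - 1)" for t
  proof (induction t)
    case 0
    then show ?case using jump[of 0] by simp
  next
    case (Suc t)
    have "B (t * n + n - 1) \<le> B (Suc t * n)"
      using le[OF Suc.prems] assms(2) by (intro mono) auto
    with Suc jump[OF Suc.prems] show ?case by linarith
  qed
  from this[of "T - 1"] have "B 0 + T \<le> B ((T - 1) * n + n - 1)" using assms(3) by simp
  moreover have "(T - 1) * n + n = T * n" using assms(3) by (cases T) auto
  ultimately show False using few by simp
qed

text \<open>
  The increasing injection of \<open>{1..q}\<close> into \<open>{1..q+1}\<close> whose image omits \<open>c\<close>, for \<open>c\<close> in the latter.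
\<close>

definition skip_color :: "nat \<Rightarrow> nat \<Rightarrow> nat" where
  "skip_color c y = (if y < c then y else Suc y)"

lemma skip_color_neq: "skip_color c y \<noteq> c"
  unfolding skip_color_def by auto

lemma skip_color_inject: "skip_color c y = skip_color c z \<longleftrightarrow> y = z"
  unfolding skip_color_def by auto

text \<open>
  The block construction. The bound on \<open>N\<close> makes \<open>2\<epsilon>d < n\<close> for every progression in the interval, so
  that the error in interpolation is less than one block.
\<close>

lemma avoidable_step:
  fixes \<epsilon> :: real and q L m k k' n N :: nat
  assumes \<epsilon>: "0 < \<epsilon>" "\<epsilon> \<le> 1/10" and L: "L \<ge> 1"
    and m: "real L / \<epsilon> + 1 \<le> real m"
    and small: "real (Suc q) * real m * real (m + 1) * (1 - 1 / real (Suc q) ^ 4) ^ L < 1"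
    and avoid: "avoidable \<epsilon> k' q n" and n: "n \<ge> 1" and k': "k' \<ge> 1"
    and k: "(10 * L + 2) * k' \<le> k"
    and N: "real N \<le> real k * real n / (4 * \<epsilon>)"
  shows "avoidable \<epsilon> k (Suc q) N"
proof -
  obtain f where f: "coloring n q f" "\<not> has_mono_approx_AP \<epsilon> k' n f"
    using avoid unfolding avoidable_def by blast
  have "0 \<le> real L / \<epsilon>" using \<epsilon>(1) by simp
  then have m1: "m \<ge> 1" using m by linarith
  obtain w where w: "\<And>i. i < m \<Longrightarrow> w i \<in> {1..Suc q}"
    and window: "\<And>c \<alpha> u. \<lbrakk>c \<in> {1..Suc q}; 4 * L \<le> u; u \<le> m\<rbrakk>
            \<Longrightarrow> \<exists>s<L. \<forall>e<4. w ((\<alpha> + s * u div L + e) mod m) = c"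
    using word_with_constant_windows_exists[of "Suc q" m L] m1 small by auto
  define block where "block x = (x - 1) div n" for x
  define pos where "pos x = (x - 1) mod n + 1" for x
  \<comment> \<open>The shift by one turns the window of candidates, which begins one block before the interpolated
    block, into an interval starting at \<open>\<alpha> + s u div L\<close>.\<close>
  define missing where "missing b = w ((b + 1) mod m)" for b
  define F where "F x = skip_color (missing (block x)) (f (pos x))" for x
  have pos: "pos x \<in> {1..n}" for x
    using n mod_less_divisor[of n "x - 1"] unfolding pos_def by (simp add: Suc_le_eq)
  have decomp: "x = pos x + block x * n" if "x \<ge> 1" for x
    using that div_mult_mod_eq[of "x - 1" n] unfolding pos_def block_def by linarith
  have F_range: "F x \<in> {1..Suc q}" for x
  proof -
    have "f (pos x) \<in> {1..q}" using f(1) pos unfolding coloring_def by blast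
    then show ?thesis unfolding F_def skip_color_def by auto
  qed
  have "\<not> has_mono_approx_AP \<epsilon> k N F"
  proof
    assume "has_mono_approx_AP \<epsilon> k N F"
    then obtain x d c where x: "approx_sequence \<epsilon> k d x"
      and xN: "\<And>i. i < k \<Longrightarrow> x i \<in> {1..N}" and xc: "\<And>i. i < k \<Longrightarrow> F (x i) = c"
      unfolding has_mono_approx_AP_iff by metis
    have "(10 * L + 2) * 1 \<le> (10 * L + 2) * k'" using k' by (intro mult_le_mono2)
    then have kL: "10 * L + 2 \<le> k" using k by simp
    then have k12: "real k \<ge> 12" using L by linarith
    have d: "d > 0" using x unfolding approx_sequence_def by blast
    have c: "c \<in> {1..Suc q}" using xc[of 0] F_range[of "x 0"] kL by simp
    have avoids_c: "missing (block (x i)) \<noteq> c" if "i < k" for i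
      using xc[OF that] skip_color_neq unfolding F_def by metis
    have x_mono: "x i \<le> x j" if "i \<le> j" "j < k" for i j
      using approx_sequence_strict_mono[OF x _ _ that(2), of i] that \<epsilon>(2) by (cases "i = j") auto
    have block_mono: "block (x i) \<le> block (x j)" if "i \<le> j" "j < k" for i j
      unfolding block_def using x_mono[OF that] by (intro div_le_mono diff_le_mono)
    have block_bounds: "real n * real (block (x i)) + 1 \<le> real (x i)"
        "real (x i) < real n * real (block (x i)) + real n + 1" if "i < k" for i
    proof -
      have "x i = pos (x i) + block (x i) * n" using decomp xN[OF that] by simp
      then have "real (x i) = real (pos (x i)) + real n * real (block (x i))"
        by (metis of_nat_add of_nat_mult mult.commute)
      then show "real n * real (block (x i)) + 1 \<le> real (x i)"
        "real (x i) < real n * real (block (x i)) + real n + 1"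
        using pos[of "x i"] by auto
    qed
    have d_upper: "2 * \<epsilon> * d < real n"
    proof -
      have "(real (k - 1) - real 0) * d - 2 * \<epsilon> * d < real (x (k - 1)) - real (x 0)"
        using approx_sequence_diff[OF x, of 0 "k - 1"] kL by linarith
      moreover have "real (x (k - 1)) \<le> real N" "real (x 0) \<ge> 1" using xN[of 0] xN[of "k - 1"] kL by auto
      ultimately have "(real k - 1 - 2 * \<epsilon>) * d < real N"
        using kL by (simp add: of_nat_diff algebra_simps)
      moreover have "real k / 2 * d \<le> (real k - 1 - 2 * \<epsilon>) * d"
      proof (rule mult_right_mono)
        show "real k / 2 \<le> real k - 1 - 2 * \<epsilon>" using k12 \<epsilon>(2) by linarith
      qed (use d in simp)
      ultimately have "real k / 2 * d < real k * real n / (4 * \<epsilon>)" using N by linarith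
      then have "real k * (2 * \<epsilon> * d) < real k * real n" using \<epsilon> by (simp add: field_simps)
      then show ?thesis by (simp add: mult_less_cancel_left)
    qed
    \<comment> \<open>With this stride, consecutive chosen terms are about five or more blocks apart, so that \<open>L\<close> strides span at least \<open>4 L\<close>
      blocks despite rounding; they span at most \<open>m\<close> blocks because of the upper bound on \<open>d\<close>.\<close>
    define j where "j = nat \<lceil>5 * real n / d\<rceil>"
    have "0 \<le> 5 * real n / d" using d by simp
    then have "5 * real n / d \<le> real j" "real j < 5 * real n / d + 1"
      unfolding j_def by linarith+
    then have j: "5 * real n \<le> real j * d" "real j * d < 5 * real n + d"
      using d by (auto simp: field_simps)
    show False
    proof (cases "j * L < k")
      case True
      \<comment> \<open>The progression is long enough to be followed over \<open>L\<close> strides.\<close>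
      define \<alpha> where "\<alpha> = block (x 0)"
      define u where "u = block (x (j * L)) - \<alpha>"
      have u: "block (x (j * L)) = \<alpha> + u"
        unfolding u_def \<alpha>_def using block_mono[of 0 "j * L"] True by simp
      have bL: "real n * (real \<alpha> + real u) + 1 \<le> real (x (j * L))"
          "real (x (j * L)) < real n * (real \<alpha> + real u) + real n + 1"
        using block_bounds[OF True] unfolding u by auto
      have b0: "real n * real \<alpha> + 1 \<le> real (x 0)" "real (x 0) < real n * real \<alpha> + real n + 1"
        using block_bounds[of 0] kL unfolding \<alpha>_def by auto
      have expand: "real n * (real \<alpha> + real u) = real n * real \<alpha> + real n * real u"
        by (simp add: algebra_simps)
      have "\<bar>real (x (j * L)) - real (x 0) - real (j * L) * d\<bar> < real n"
        using approx_sequence_diff[OF x, of 0 "j * L"] True kL d_upper by simp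
      then have span: "real (j * L) * d - 2 * real n < real n * real u"
          "real n * real u < real (j * L) * d + 2 * real n"
        using bL b0 expand by linarith+
      have jLd: "real (j * L) * d = real L * (real j * d)" by simp
      have "4 * L \<le> u"
      proof -
        have "real L * (5 * real n) \<le> real (j * L) * d" unfolding jLd using j(1) by (intro mult_left_mono) auto
        moreover have "real n * 1 \<le> real n * real L" using L by (intro mult_left_mono) auto
        ultimately have "real n * (4 * real L - 1) < real n * real u"
          using span(1) by (simp add: algebra_simps)
        then have "4 * real L - 1 < real u" by (simp add: mult_less_cancel_left)
        then show ?thesis by linarith
      qed
      moreover have "u \<le> m"
      proof -
        have "d < real n / (2 * \<epsilon>)" using d_upper \<epsilon>(1) by (simp add: field_simps)
        moreover have "5 * real n \<le> real n / (2 * \<epsilon>)"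
          using \<epsilon> n by (simp add: field_simps)
        ultimately have "real j * d \<le> real n / (2 * \<epsilon>) + real n / (2 * \<epsilon>)" using j(2) by linarith
        also have "\<dots> = real n / \<epsilon>" using \<epsilon>(1) by (simp add: field_simps)
        finally have "real (j * L) * d \<le> real L * (real n / \<epsilon>)"
          unfolding jLd by (intro mult_left_mono) auto
        also have "\<dots> = real n * (real L / \<epsilon>)" by simp
        also have "\<dots> \<le> real n * (real m - 1)" using m by (intro mult_left_mono) auto
        finally have "real n * real u < real n * (real m + 1)"
          using span(2) by (simp add: algebra_simps)
        then have "real u < real m + 1" by (simp add: mult_less_cancel_left)
        then show ?thesis by linarith
      qed
      ultimately obtain s where s: "s < L" "\<And>e. e < 4 \<Longrightarrow> w ((\<alpha> + s * u div L + e) mod m) = c"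
        using window[OF c] by blast
      define b where "b = block (x (j * s))"
      have js: "j * s < k" using s(1) True by (meson le_less_trans less_imp_le mult_le_mono2)
      have bs: "real n * real b + 1 \<le> real (x (j * s))" "real (x (j * s)) < real n * real b + real n + 1"
        using block_bounds[OF js] unfolding b_def by auto
      have "\<bar>real L * real (x (j * s)) - ((real L - real s) * real (x 0) + real s * real (x (j * L)))\<bar>
           < real L * real n"
      proof -
        have "real L * (2 * \<epsilon> * d) < real L * real n" using d_upper L by simp
        then show ?thesis using approx_sequence_interpolate[OF x, of s L j] s(1) True by linarith
      qed
      moreover have "(real L - real s) * (real n * real \<alpha> + 1) \<le> (real L - real s) * real (x 0)"
          "(real L - real s) * real (x 0) \<le> (real L - real s) * (real n * real \<alpha> + real n + 1)"
        using b0 s(1) by (auto intro!: mult_left_mono)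
      moreover have "real s * (real n * (real \<alpha> + real u) + 1) \<le> real s * real (x (j * L))"
          "real s * real (x (j * L)) \<le> real s * (real n * (real \<alpha> + real u) + real n + 1)"
        using bL by (auto intro!: mult_left_mono)
      moreover have "real L * (real n * real b + 1) \<le> real L * real (x (j * s))"
          "real L * real (x (j * s)) < real L * (real n * real b + real n + 1)"
        using bs L by (auto intro!: mult_left_mono)
      ultimately have "real n * (real L * real \<alpha> + real s * real u) < real n * (real L * (real b + 2))"
          "real n * (real L * real b) < real n * (real L * real \<alpha> + real s * real u + 2 * real L)"
        by (simp_all add: algebra_simps)
      then have "real L * real \<alpha> + real s * real u < real L * (real b + 2)"
          "real L * real b < real L * real \<alpha> + real s * real u + 2 * real L"
        by (simp_all only: mult_less_cancel_left)
      then have "real (L * \<alpha> + s * u) < real (L * (b + 2))" "real (L * b) < real (L * \<alpha> + s * u + 2 * L)"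
        by (simp_all add: algebra_simps)
      then have near: "L * \<alpha> + s * u < L * (b + 2)" "L * b < L * \<alpha> + s * u + 2 * L"
        by (simp_all only: of_nat_less_iff)
      \<comment> \<open>Hence \<open>b\<close> is the interpolated block, its predecessor, or one of its next two successors.\<close>
      define v where "v = s * u div L"
      have v: "L * v \<le> s * u" "s * u < L * v + L"
        unfolding v_def using L dividend_less_times_div[of L "s * u"] by auto
      have "L * (\<alpha> + v) < L * (b + 2)" "L * b < L * (\<alpha> + v + 3)"
        using near v unfolding distrib_left by linarith+
      then have "\<alpha> + v < b + 2" "b < \<alpha> + v + 3" by (simp_all only: mult_less_cancel1)
      then have "b + 1 = \<alpha> + v + (b + 1 - (\<alpha> + v))" "b + 1 - (\<alpha> + v) < 4" by auto
      then have "missing b = c" unfolding missing_def using s(2) unfolding v_def by metis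
      then show False using avoids_c[OF js] unfolding b_def by simp
    next
      case False
      \<comment> \<open>The whole progression covers a distance of less than \<open>10 L\<close> blocks, so \<open>k'\<close> consecutive terms
        share a block.\<close>
      have kd: "real k * d < 10 * real n * real L"
      proof -
        have "real k \<le> real (j * L)" using False by (intro of_nat_mono) simp
        then have "real k * d \<le> real (j * L) * d" using d by (intro mult_right_mono) auto
        also have "\<dots> = real L * (real j * d)" by simp
        also have "\<dots> < real L * (5 * real n + d)" using j(2) L by (intro mult_strict_left_mono) auto
        finally have "real k * d < 5 * real n * real L + real L * d" by (simp add: algebra_simps)
        moreover have "real L * d \<le> real k / 2 * d" using kL d by (intro mult_right_mono) auto
        ultimately show ?thesis by simp
      qed
      define T where "T = 10 * L + 2"
      have T: "T \<ge> 1" "T * k' \<le> k" "T * k' \<ge> 1" using k k' unfolding T_def by auto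
      define last where "last = T * k' - 1"
      have last: "last < k" using T unfolding last_def by linarith
      have "block (x last) < block (x 0) + T"
      proof -
        have "\<bar>(real (x last) - real (x 0)) - (real last - real 0) * d\<bar> < 2 * \<epsilon> * d"
          using approx_sequence_diff[OF x, of 0 last] last by simp
        moreover have "real last * d \<le> real k * d" using last d by (intro mult_right_mono) auto
        ultimately have "real (x last) - real (x 0) < 10 * real n * real L + real n"
          using d_upper kd by simp
        then have "real n * real (block (x last)) < real n * (real (block (x 0)) + 10 * real L + 2)"
          using block_bounds[OF last] block_bounds[of 0] kL by (simp add: algebra_simps)
        then have "real (block (x last)) < real (block (x 0)) + 10 * real L + 2"
          by (simp add: mult_less_cancel_left)
        then show ?thesis unfolding T_def by linarith
      qed
      then obtain t where t: "t < T" "\<And>i. i < k' \<Longrightarrow> block (x (t * k' + i)) = block (x (t * k'))"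
        using constant_stretch_exists[of T k' "\<lambda>i. block (x i)"] block_mono T k' unfolding last_def
        by (metis less_le_trans)
      define b where "b = block (x (t * k'))"
      define y where "y i = pos (x (t * k' + i))" for i
      have tk: "t * k' + k' \<le> k" using mult_le_mono1[of "Suc t" T k'] t(1) T(2) by simp
      have "approx_sequence \<epsilon> k' d y"
      proof (rule approx_sequence_shift[OF x tk])
        fix i assume i: "i < k'"
        then have "x (t * k' + i) \<ge> 1" using xN[of "t * k' + i"] tk by simp
        then show "x (t * k' + i) = y i + b * n"
          using decomp[of "x (t * k' + i)"] t(2)[OF i] unfolding y_def b_def by simp
      qed
      moreover have "y i \<in> {1..n} \<and> f (y i) = f (y 0)" if "i < k'" for i
      proof -
        have "skip_color (missing b) (f (y i)) = c" if "i < k'" for i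
          using xc[of "t * k' + i"] t(2)[OF that] tk that unfolding F_def y_def b_def by simp
        from this[OF that] this[of 0] show ?thesis
          using pos k' skip_color_inject unfolding y_def by (metis less_le_trans zero_less_one)
      qed
      ultimately have "has_mono_approx_AP \<epsilon> k' n f" unfolding has_mono_approx_AP_iff by blast
      with f(2) show False ..
    qed
  qed
  moreover have "coloring N (Suc q) F" unfolding coloring_def using F_range by blast
  ultimately show ?thesis unfolding avoidable_def by blast
qed


section \<open>The lower bound\<close>

text \<open>
  Taking the length of the progressions as \<open>\<kappa> K^q\<close>, and \<open>M\<close> as an integer at most \<open>1 / (4\<epsilon>)\<close>, keeps all
  quantities in the recursion integral: with \<open>q + 1\<close> colours, the next length is the product of the
  current one, \<open>M\<close>, and \<open>\<kappa> K^(q+1)\<close>. The same word parameters \<open>L\<close> and \<open>m\<close> serve all steps,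
  because the requirement on them is strongest for the final number \<open>r\<close> of colours.
\<close>

lemma avoidable_iterated:
  fixes \<epsilon> :: real and r L m \<kappa> M q :: nat
  defines "K \<equiv> 10 * L + 2"
  assumes \<epsilon>: "0 < \<epsilon>" "\<epsilon> \<le> 1/10" and L: "L \<ge> 1"
    and m: "real L / \<epsilon> + 1 \<le> real m"
    and small: "real r * real m * real (m + 1) * (1 - 1 / real r ^ 4) ^ L < 1"
    and \<kappa>: "\<kappa> \<ge> 2" and M: "M \<ge> 1" "real M \<le> 1 / (4 * \<epsilon>)"
    and q: "Suc q \<le> r"
  shows "avoidable \<epsilon> (\<kappa> * K ^ q) (Suc q) ((\<kappa> - 1) * (\<kappa> * M) ^ q * K ^ (Suc q choose 2))"
  using q
proof (induction q)
  case 0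
  have "\<kappa> - 1 < \<kappa>" using \<kappa> by simp
  then have "avoidable \<epsilon> \<kappa> 1 (\<kappa> - 1)" using \<epsilon> by (intro avoidable_one_color) auto
  then show ?case by (simp add: numeral_2_eq_2)
next
  case (Suc q)
  define n where "n = (\<kappa> - 1) * (\<kappa> * M) ^ q * K ^ (Suc q choose 2)"
  have K: "K \<ge> 1" unfolding K_def by simp
  have choose: "Suc (Suc q) choose 2 = Suc q + (Suc q choose 2)"
    by (simp add: numeral_2_eq_2)
  have N: "(\<kappa> - 1) * (\<kappa> * M) ^ Suc q * K ^ (Suc (Suc q) choose 2) = (\<kappa> * K ^ Suc q) * n * M"
    unfolding n_def choose by (simp add: power_add mult_ac)
  have "avoidable \<epsilon> (\<kappa> * K ^ Suc q) (Suc (Suc q)) ((\<kappa> * K ^ Suc q) * n * M)"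
  proof (rule avoidable_step[OF \<epsilon> L m])
    show "avoidable \<epsilon> (\<kappa> * K ^ q) (Suc q) n" unfolding n_def using Suc by simp
    show "n \<ge> 1" "\<kappa> * K ^ q \<ge> 1" unfolding n_def using \<kappa> K M(1) by (auto simp: Suc_le_eq)
    show "(10 * L + 2) * (\<kappa> * K ^ q) \<le> \<kappa> * K ^ Suc q" by (simp add: K_def mult.left_commute)
    have "real (\<kappa> * K ^ Suc q * n) * real M \<le> real (\<kappa> * K ^ Suc q * n) * (1 / (4 * \<epsilon>))"
      using M(2) by (intro mult_left_mono) auto
    then show "real (\<kappa> * K ^ Suc q * n * M) \<le> real (\<kappa> * K ^ Suc q) * real n / (4 * \<epsilon>)"
      by simp
    have qr: "1 \<le> real (Suc (Suc q))" "real (Suc (Suc q)) \<le> real r" using Suc.prems by linarith+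
    have "1 / real r ^ 4 \<le> 1 / real (Suc (Suc q)) ^ 4"
      using qr by (intro divide_left_mono power_mono mult_pos_pos) auto
    moreover have "1 / real (Suc (Suc q)) ^ 4 \<le> 1"
      using qr(1) one_le_power[OF qr(1), of 4] by (simp add: divide_le_eq_1)
    ultimately have "(1 - 1 / real (Suc (Suc q)) ^ 4) ^ L \<le> (1 - 1 / real r ^ 4) ^ L"
      by (intro power_mono) linarith+
    moreover have "0 \<le> (1 - 1 / real (Suc (Suc q)) ^ 4) ^ L"
      using \<open>1 / real (Suc (Suc q)) ^ 4 \<le> 1\<close> by (intro zero_le_power) linarith
    ultimately have "real (Suc (Suc q)) * real m * real (m + 1) * (1 - 1 / real (Suc (Suc q)) ^ 4) ^ L
        \<le> real r * real m * real (m + 1) * (1 - 1 / real r ^ 4) ^ L"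
      using qr by (intro mult_mono) auto
    with small show "real (Suc (Suc q)) * real m * real (m + 1) * (1 - 1 / real (Suc (Suc q)) ^ 4) ^ L < 1"
      by linarith
  qed
  then show ?case unfolding N .
qed

lemma exp_dominates_power:
  fixes A :: real
  obtains X where "\<And>x. x \<ge> X \<Longrightarrow> A * x ^ n < exp x"
proof -
  have "((\<lambda>x. A * (x ^ n / exp x)) \<longlongrightarrow> A * 0) at_top"
    by (intro tendsto_mult_left tendsto_power_div_exp_0)
  then have "eventually (\<lambda>x. A * (x ^ n / exp x) < 1) at_top"
    by (rule order_tendstoD) simp
  then obtain X where "\<And>x. x \<ge> X \<Longrightarrow> A * (x ^ n / exp x) < 1"
    unfolding eventually_at_top_linorder by blast
  then have "A * x ^ n < exp x" if "x \<ge> X" for x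
    using that by (simp add: divide_less_eq)
  then show ?thesis by (rule that)
qed

lemma power_one_minus_le_exp:
  fixes p y :: real
  assumes "0 \<le> p" "p \<le> 1" "y \<le> real L * p"
  shows "(1 - p) ^ L \<le> exp (- y)"
proof -
  have "(1 - p) ^ L \<le> exp (- p) ^ L"
    using assms exp_ge_add_one_self[of "- p"] by (intro power_mono) auto
  also have "\<dots> = exp (- (real L * p))" by (simp flip: exp_of_nat_mult)
  also have "\<dots> \<le> exp (- y)" using assms(3) by simp
  finally show ?thesis .
qed

text \<open>
  Here \<open>x\<close> is \<open>log(1/\<epsilon>)\<close>. The choice of \<open>L\<close>, about \<open>3 r^4 x\<close>, makes the failure probability in the
  word lemma at most \<open>\<epsilon>^3\<close>, which beats the number \<open>O(x^2 / \<epsilon>^2)\<close> of events; the third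
  hypothesis ensures that. The constant \<open>D\<close> satisfies \<open>10 L + 2 \<le> D x\<close>, and the fourth
  hypothesis provides \<open>k \<ge> 2 (10 L + 2)^R\<close>, so that dividing \<open>k\<close> by this power loses at most a
  factor \<open>2\<close> in rounding.
\<close>

lemma W_lower_explicit:
  fixes \<epsilon> x D :: real and k R :: nat
  defines "r \<equiv> Suc R" and "D \<equiv> 48 * real (Suc R) ^ 4"
  assumes \<epsilon>: "\<epsilon> = exp (- x)" and x: "x \<ge> 5"
    and x2: "16 * real r * (4 * real r ^ 4)\<^sup>2 * x\<^sup>2 < exp x"
    and xR: "2 * D ^ R * x ^ R < exp x"
    and k: "exp x \<le> real k"
  shows "1 / (2 * 2 ^ r * 8 ^ R * D ^ (r choose 2)) * (real k ^ r / (\<epsilon> ^ R * x ^ (r choose 2)))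
          \<le> real (W \<epsilon> k r)"
proof -
  have r: "r \<ge> 1" "real r \<ge> 1" unfolding r_def by auto
  have r4: "1 \<le> real r ^ 4" using r(2) by (rule one_le_power)
  have r4_pos: "0 < real r ^ 4" and r4_inv: "1 / real r ^ 4 \<le> 1"
    using r4 r(1) by (auto simp: divide_le_eq_1)
  have inv: "1 / \<epsilon> = exp x" unfolding \<epsilon> by (simp add: exp_minus field_simps)
  have big: "exp x \<ge> 16"
  proof -
    have "2 * 2 * 2 * 2 \<le> exp 1 * exp 1 * exp 1 * (exp 1 :: real)"
      using exp_ge_add_one_self[of 1] by (intro mult_mono) auto
    also have "\<dots> = exp 4" by (simp flip: exp_add)
    also have "\<dots> \<le> exp x" using x by simp
    finally show ?thesis by simp
  qed
  have \<epsilon>01: "0 < \<epsilon>" "\<epsilon> \<le> 1/10"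
    using inv big unfolding \<epsilon> by (auto simp: field_simps exp_minus)
  define L where "L = nat \<lceil>3 * real r ^ 4 * x\<rceil>"
  define C where "C = 4 * real r ^ 4"
  have "1 * 1 \<le> real r ^ 4 * x" using r4 x by (intro mult_mono) auto
  then have Lx: "3 * real r ^ 4 * x \<le> real L" "real L \<le> C * x" "L \<ge> 1"
    unfolding L_def C_def by linarith+
  define m where "m = nat \<lceil>real L / \<epsilon>\<rceil> + 1"
  have Le: "1 \<le> real L / \<epsilon>" using Lx(3) \<epsilon>01 by (simp add: field_simps)
  then have m: "real L / \<epsilon> + 1 \<le> real m" "real m + 1 \<le> 4 * (real L / \<epsilon>)"
    unfolding m_def by linarith+
  have small: "real r * real m * real (m + 1) * (1 - 1 / real r ^ 4) ^ L < 1"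
  proof -
    define Y where "Y = C * x * exp x"
    have Y: "Y \<ge> 0" unfolding Y_def C_def using x by simp
    have mY: "real m + 1 \<le> 4 * Y"
    proof -
      have "real L / \<epsilon> = real L * exp x" using inv by (metis divide_inverse inverse_eq_divide)
      also have "\<dots> \<le> Y" unfolding Y_def using Lx(2) by (intro mult_right_mono) auto
      finally show ?thesis using m(2) by linarith
    qed
    have "3 * x \<le> real L * (1 / real r ^ 4)"
      using Lx(1) r4_pos by (simp add: pos_le_divide_eq mult_ac)
    then have dec: "(1 - 1 / real r ^ 4) ^ L \<le> exp (- (3 * x))"
      using r4_inv by (intro power_one_minus_le_exp) auto
    have pos: "0 \<le> (1 - 1 / real r ^ 4) ^ L" using r4_inv by (intro zero_le_power) simp
    have "real r * real m * real (m + 1) \<le> real r * (4 * Y) * (4 * Y)"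
      using mY Y by (intro mult_mono) auto
    moreover have "0 \<le> real r * (4 * Y) * (4 * Y)" using Y by (intro mult_nonneg_nonneg) auto
    ultimately have "real r * real m * real (m + 1) * (1 - 1 / real r ^ 4) ^ L
      \<le> (real r * (4 * Y) * (4 * Y)) * exp (- (3 * x))"
      using dec pos by (intro mult_mono[of "real r * real m * real (m + 1)"])
    also have "\<dots> = 16 * real r * C\<^sup>2 * x\<^sup>2 * (exp x * exp x * exp (- (3 * x)))"
      unfolding Y_def by (simp add: power2_eq_square mult_ac)
    also have "exp x * exp x * exp (- (3 * x)) = exp (- x)"
      by (simp flip: exp_add)
    also have "16 * real r * C\<^sup>2 * x\<^sup>2 * exp (- x) < exp x * exp (- x)"
      using x2 unfolding C_def by (intro mult_strict_right_mono) auto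
    also have "\<dots> = 1" by (simp flip: exp_add)
    finally show ?thesis .
  qed
  define K where "K = 10 * L + 2"
  have K1: "K \<ge> 1" unfolding K_def by simp
  have KD: "real K \<le> D * x"
  proof -
    have "real K \<le> 12 * real L" using Lx(3) unfolding K_def by simp
    also have "\<dots> \<le> 12 * (C * x)" using Lx(2) by simp
    finally show ?thesis unfolding D_def C_def r_def by simp
  qed
  define \<kappa> where "\<kappa> = k div K ^ R"
  have KR: "2 * real K ^ R \<le> real k"
  proof -
    have "real K ^ R \<le> (D * x) ^ R" using KD by (intro power_mono) auto
    then show ?thesis using xR k by (simp add: power_mult_distrib)
  qed
  have KRpos: "0 < real K ^ R" using K1 by simp
  have \<kappa>2: "\<kappa> \<ge> 2"
  proof -
    have "real (2 * K ^ R) \<le> real k" using KR by simp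
    then have "2 * K ^ R \<le> k" by (simp only: of_nat_le_iff)
    then have "2 * K ^ R div K ^ R \<le> \<kappa>" unfolding \<kappa>_def by (rule div_le_mono)
    then show ?thesis using K1 by simp
  qed
  have \<kappa>_lower: "real k / (2 * real K ^ R) \<le> real \<kappa>"
  proof -
    have "k < K ^ R * Suc \<kappa>"
      unfolding \<kappa>_def using K1 dividend_less_times_div[of "K ^ R" k] by simp
    then have "real k < real (K ^ R * Suc \<kappa>)" by (simp only: of_nat_less_iff)
    then have "real k < real K ^ R * (real \<kappa> + 1)" by (simp add: algebra_simps)
    also have "\<dots> \<le> real K ^ R * (2 * real \<kappa>)" using \<kappa>2 KRpos by (intro mult_left_mono) auto
    finally show ?thesis using KRpos by (simp add: field_simps)
  qed
  define M where "M = nat \<lfloor>1 / (4 * \<epsilon>)\<rfloor>"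
  have "1 / (4 * \<epsilon>) = exp x / 4" "1 / (8 * \<epsilon>) = exp x / 8" unfolding inv[symmetric] by simp_all
  then have M: "M \<ge> 1" "real M \<le> 1 / (4 * \<epsilon>)" "1 / (8 * \<epsilon>) \<le> real M"
    unfolding M_def using big by linarith+
  \<comment> \<open>The construction for \<open>r\<close> colours; the bound in the statement is what remains after inserting the
    lower estimates for \<open>\<kappa>\<close> and \<open>M\<close>.\<close>
  define N where "N = (\<kappa> - 1) * (\<kappa> * M) ^ R * K ^ (r choose 2)"
  have "avoidable \<epsilon> (\<kappa> * K ^ R) r N"
    using avoidable_iterated[OF \<epsilon>01 Lx(3) m(1) small \<kappa>2 M(1,2), of R]
    unfolding N_def K_def r_def by simp
  moreover have "\<kappa> * K ^ R \<le> k" unfolding \<kappa>_def by simp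
  ultimately have "avoidable \<epsilon> k (Suc R) N" unfolding r_def[symmetric] by (rule avoidable_mono)
  moreover have "k \<ge> 1" using k big by linarith
  ultimately have NW: "N < W \<epsilon> k r"
    using avoidable_less_W \<epsilon>01 unfolding r_def by simp
  \<comment> \<open>The power of \<open>K\<close> lost in \<open>\<kappa>^r\<close> has twice the exponent of the one gained, which leaves \<open>r choose 2\<close>
    logarithms in the denominator.\<close>
  have r_choose: "R * r = (r choose 2) + (r choose 2)"
  proof -
    have "even (r * (r - 1))" by auto
    then have "2 * (r choose 2) = r * (r - 1)" unfolding choose_two by (rule dvd_mult_div_cancel)
    then show ?thesis unfolding r_def by simp
  qed
  have "1 / (2 * 2 ^ r * 8 ^ R * D ^ (r choose 2)) * (real k ^ r / (\<epsilon> ^ R * x ^ (r choose 2)))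
      = (1 / 2) * (real k / 2) ^ r * (1 / (8 * \<epsilon>)) ^ R * (1 / (D * x) ^ (r choose 2))"
    by (simp add: power_mult_distrib power_divide)
  also have "\<dots> \<le> (1 / 2) * (real k / 2) ^ r * (1 / (8 * \<epsilon>)) ^ R * (1 / real K ^ (r choose 2))"
    using KD K1 \<epsilon>01 by (intro mult_left_mono divide_left_mono power_mono mult_pos_pos) auto
  also have "\<dots> = (1 / 2) * (real k / (2 * real K ^ R)) ^ r * (1 / (8 * \<epsilon>)) ^ R * real K ^ (r choose 2)"
    using K1 by (simp add: power_divide power_mult_distrib r_choose power_add flip: power_mult)
  also have "\<dots> \<le> (1 / 2) * real \<kappa> ^ r * real M ^ R * real K ^ (r choose 2)"
    using \<kappa>_lower M(3) \<epsilon>01 by (intro mult_mono power_mono) auto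
  also have "\<dots> = (real \<kappa> / 2) * (real \<kappa> * real M) ^ R * real K ^ (r choose 2)"
    unfolding r_def by (simp add: power_mult_distrib mult_ac)
  also have "\<dots> \<le> real (\<kappa> - 1) * (real \<kappa> * real M) ^ R * real K ^ (r choose 2)"
    using \<kappa>2 by (intro mult_right_mono) auto
  also have "\<dots> = real N" unfolding N_def by simp
  also have "\<dots> \<le> real (W \<epsilon> k r)" using NW by simp
  finally show ?thesis .
qed

theorem theorem1p3:
  fixes r :: nat
  assumes "r \<ge> 1"
  shows "\<exists>(\<epsilon>\<^sub>0 :: real) > 0. \<exists>(c :: real) > 0. \<forall>(\<epsilon> :: real) (k :: nat).
    0 < \<epsilon> \<and> \<epsilon> \<le> \<epsilon>\<^sub>0 \<and>
    real k \<ge> 2 ^ r * fact r * (1 / \<epsilon>) * (ln (1 / (5 * \<epsilon>))) ^ r \<longrightarrow>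
    c * (real k ^ r / (\<epsilon> ^ (r - 1) * (ln (1 / \<epsilon>)) ^ (((r + 1) choose 2) - 1))) \<le> real (W \<epsilon> k r) \<and>
    real (W \<epsilon> k r) \<le> 2 * real k ^ r / \<epsilon> ^ (r - 1)"
proof -
  obtain R where R: "r = Suc R" using assms by (cases r) auto
  define D where "D = 48 * real r ^ 4"
  define c where "c = 1 / (2 * 2 ^ r * 8 ^ R * D ^ (r choose 2))"
  have "D > 0" unfolding D_def using R by simp
  then have c: "c > 0" unfolding c_def by simp
  obtain X2 where X2: "\<And>x. x \<ge> X2 \<Longrightarrow> 16 * real r * (4 * real r ^ 4)\<^sup>2 * x\<^sup>2 < exp x"
    using exp_dominates_power by blast
  obtain XR where XR: "\<And>x. x \<ge> XR \<Longrightarrow> 2 * D ^ R * x ^ R < exp x"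
    using exp_dominates_power by blast
  define X where "X = max 5 (max X2 XR)"
  show ?thesis
  proof (rule exI[of _ "exp (- X)"], rule conjI[OF exp_gt_zero], rule exI[of _ c],
      rule conjI[OF c], intro allI impI conjI)
    fix \<epsilon> :: real and k :: nat
    assume "0 < \<epsilon> \<and> \<epsilon> \<le> exp (- X) \<and>
      real k \<ge> 2 ^ r * fact r * (1 / \<epsilon>) * (ln (1 / (5 * \<epsilon>))) ^ r"
    then have \<epsilon>: "0 < \<epsilon>" "\<epsilon> \<le> exp (- X)"
      and k: "real k \<ge> 2 ^ r * fact r * (1 / \<epsilon>) * (ln (1 / (5 * \<epsilon>))) ^ r" by auto
    define x where "x = ln (1 / \<epsilon>)"
    have \<epsilon>x: "\<epsilon> = exp (- x)" unfolding x_def using \<epsilon>(1) by (simp add: ln_div)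
    have "x \<ge> X" using \<epsilon>(2) unfolding \<epsilon>x by simp
    then have x: "x \<ge> 5" "x \<ge> X2" "x \<ge> XR" unfolding X_def by auto
    \<comment> \<open>From \<open>x \<ge> 5 \<ge> 1 + log 5\<close> the logarithm in the hypothesis on \<open>k\<close> is at least one.\<close>
    have kx: "exp x \<le> real k"
    proof -
      have "ln (1 / (5 * \<epsilon>)) = x - ln 5" unfolding x_def using \<epsilon>(1) by (simp add: ln_div ln_mult)
      moreover have "ln 5 \<le> (4 :: real)" using ln_le_minus_one[of "5 :: real"] by simp
      ultimately have "1 \<le> ln (1 / (5 * \<epsilon>)) ^ r" using x(1) by (intro one_le_power) linarith
      moreover have "1 \<le> 2 ^ r * (fact r :: real)"
        using mult_mono[of 1 "2 ^ r :: real" 1 "fact r"] by (simp add: fact_ge_1)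
      ultimately have "1 * exp x * 1 \<le> (2 ^ r * fact r) * exp x * ln (1 / (5 * \<epsilon>)) ^ r"
        by (intro mult_mono) auto
      moreover have "exp x = 1 / \<epsilon>" unfolding \<epsilon>x by (simp add: exp_minus field_simps)
      ultimately show ?thesis using k by simp
    qed
    have "c * (real k ^ r / (\<epsilon> ^ R * x ^ ((r + 1 choose 2) - 1)))
        \<le> c * (real k ^ r / (\<epsilon> ^ R * x ^ (r choose 2)))"
    proof (intro mult_left_mono divide_left_mono mult_pos_pos)
      have "(r choose 2) \<le> (r + 1 choose 2) - 1" unfolding R by (simp add: numeral_2_eq_2)
      then show "x ^ (r choose 2) \<le> x ^ ((r + 1 choose 2) - 1)"
        using x(1) by (intro power_increasing) auto
    qed (use c x \<epsilon>(1) in auto)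
    also have "\<dots> \<le> real (W \<epsilon> k r)"
      using W_lower_explicit[OF \<epsilon>x x(1), of R k] X2[OF x(2)] XR[OF x(3)] kx
      unfolding c_def D_def R by simp
    finally show "c * (real k ^ r / (\<epsilon> ^ (r - 1) * (ln (1 / \<epsilon>)) ^ (((r + 1) choose 2) - 1))) \<le> real (W \<epsilon> k r)"
      unfolding x_def R by simp
    have "exp x \<ge> 6" using exp_ge_add_one_self[of x] x(1) by linarith
    then have \<epsilon>2: "\<epsilon> \<le> 1/2" unfolding \<epsilon>x by (simp add: exp_minus field_simps)
    have "k \<ge> 1" using kx \<open>exp x \<ge> 6\<close> by linarith
    then have "real (W \<epsilon> k r) \<le> real k ^ r / (2 * \<epsilon>) ^ R"
      using W_upper(1)[OF _ \<epsilon>(1) \<epsilon>2] unfolding R by simp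
    also have "\<dots> \<le> real k ^ r / \<epsilon> ^ R"
      using \<epsilon>(1) by (intro divide_left_mono power_mono) auto
    also have "\<dots> \<le> 2 * (real k ^ r / \<epsilon> ^ R)"
    proof -
      have "0 \<le> real k ^ r / \<epsilon> ^ R" using \<epsilon>(1) by simp
      then show ?thesis by linarith
    qed
    finally show "real (W \<epsilon> k r) \<le> 2 * real k ^ r / \<epsilon> ^ (r - 1)" unfolding R by simp
  qed
qed

end
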